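(* If $Y$ is a dense subspace of a Tychonoff space $X$, then $|C(X)|\leq nw(Y)^{Nag(Y)}$ and $w(X)\leq nw(Y)^{Nag(Y)}$.
   Context: All spaces are Tychonoff; cardinal invariants take infinite values. $C(X)$ is the set of continuous real-valued functions on $X$; $nw$ is network weight, $w$ weight. The Nagami number $Nag(Y)$ is the minimal cardinality of a family $\mathcal F$ of closed subsets of $\beta Y$ such that for every $y\in Y$ and $z\in\beta Y\setminus Y$ there is $F\in\mathcal F$ with $y\in F$, $z\notin F$. *)

theory Defs
  imports "HOL-Analysis.Analysis"
begin

definition tychonoff_space :: "'a topology \<Rightarrow> bool" where
  "tychonoff_space X \<longleftrightarrow> completely_regular_space X \<and> t1_space X"

text \<open>C(X): continuous real-valued functions on X (taken extensional, i.e. undefined outside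
  the carrier, so that distinct elements are distinct functions on X).\<close>
definition Cfun :: "'a topology \<Rightarrow> ('a \<Rightarrow> real) set" where
  "Cfun X = {f. continuous_map X euclideanreal f \<and> f \<in> extensional (topspace X)}"

definition network_of :: "'a topology \<Rightarrow> 'a set set \<Rightarrow> bool" where
  "network_of X N \<longleftrightarrow> N \<subseteq> Pow (topspace X) \<and>
     (\<forall>U x. openin X U \<and> x \<in> U \<longrightarrow> (\<exists>A\<in>N. x \<in> A \<and> A \<subseteq> U))"

definition open_base_of :: "'a topology \<Rightarrow> 'a set set \<Rightarrow> bool" where
  "open_base_of X B \<longleftrightarrow> (\<forall>A\<in>B. openin X A) \<and>
     (\<forall>U x. openin X U \<and> x \<in> U \<longrightarrow> (\<exists>A\<in>B. x \<in> A \<and> A \<subseteq> U))"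

definition mincard_family :: "('b set \<Rightarrow> bool) \<Rightarrow> 'b set" where
  "mincard_family P = (SOME N. P N \<and> (\<forall>M. P M \<longrightarrow> ordLeq2 (card_of N) (card_of M)))"

text \<open>Cardinal invariants take infinite values: kappa(X) = omega + min cardinality.\<close>
definition nw :: "'a topology \<Rightarrow> ('a set + nat) rel" where
  "nw X = card_of (mincard_family (network_of X) <+> (UNIV :: nat set))"

definition wt :: "'a topology \<Rightarrow> ('a set + nat) rel" where
  "wt X = card_of (mincard_family (open_base_of X) <+> (UNIV :: nat set))"

text \<open>Stone-Cech compactification of a Tychonoff space Y, standard construction:
  closure of the evaluation image of Y in the cube [0,1]^I, I = continuous maps Y \<rightarrow> [0,1].\<close>
definition scI :: "'a topology \<Rightarrow> ('a \<Rightarrow> real) set" where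
  "scI Y = {f. continuous_map Y (top_of_set {0..1}) f \<and> f \<in> extensional (topspace Y)}"

definition sc_emb :: "'a topology \<Rightarrow> 'a \<Rightarrow> ('a \<Rightarrow> real) \<Rightarrow> real" where
  "sc_emb Y y = restrict (\<lambda>f. f y) (scI Y)"

definition sc_cube :: "'a topology \<Rightarrow> (('a \<Rightarrow> real) \<Rightarrow> real) topology" where
  "sc_cube Y = product_topology (\<lambda>f. top_of_set {0..1}) (scI Y)"

definition beta :: "'a topology \<Rightarrow> (('a \<Rightarrow> real) \<Rightarrow> real) topology" where
  "beta Y = subtopology (sc_cube Y) (sc_cube Y closure_of (sc_emb Y ` topspace Y))"

definition nagami_family :: "'a topology \<Rightarrow> (('a \<Rightarrow> real) \<Rightarrow> real) set set \<Rightarrow> bool" where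
  "nagami_family Y \<F> \<longleftrightarrow> (\<forall>F\<in>\<F>. closedin (beta Y) F) \<and>
     (\<forall>y\<in>topspace Y. \<forall>z\<in>topspace (beta Y) - sc_emb Y ` topspace Y.
        \<exists>F\<in>\<F>. sc_emb Y y \<in> F \<and> z \<notin> F)"

definition Nag :: "'a topology \<Rightarrow> ((('a \<Rightarrow> real) \<Rightarrow> real) set + nat) rel" where
  "Nag Y = card_of (mincard_family (nagami_family Y) <+> (UNIV :: nat set))"

end

theory Submission
  imports Defs "HOL-Algebra.Free_Abelian_Groups"
begin

text \<open>For a continuous function \<open>f\<close> on the dense subspace \<open>Y\<close> and rationals \<open>p < q\<close>, a set lying
  between \<open>{f \<le> p}\<close> and \<open>{f < q}\<close> can be patched together from few pieces. Let \<open>\<F>\<close> be a Nagami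
  family. The members of \<open>\<F>\<close> through a point \<open>y\<close> intersect in a compact subset \<open>K\<close> of \<open>Y\<close>.
  A network of \<open>Y\<close> gives a lattice \<open>V\<close> of \<open>nw(Y)\<close> sets that separates disjoint compact sets,
  so some \<open>W \<in> V\<close> separates \<open>K \<inter> {f \<le> p}\<close> from \<open>K \<inter> {f \<ge> q}\<close>, and by compactness of \<open>\<beta>Y\<close> it
  still separates these two sets on the intersection of finitely many members of \<open>\<F>\<close> around \<open>K\<close>.
  Choosing an element of \<open>V\<close> for each finite subfamily of \<open>\<F>\<close> and each pair \<open>(p, q)\<close> therefore
  codes \<open>f\<close>, and there are at most \<open>nw(Y)\<close> to the power \<open>Nag(Y)\<close> codes. The cozero sets
  of functions in \<open>C(X)\<close> form a base of \<open>X\<close>, which bounds the weight.\<close>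

section \<open>Minimal cardinals and lattices of sets\<close>

text \<open>Cardinals are well-ordered, so the choice behind \<open>mincard_family\<close> has a
  candidate as soon as some set satisfies \<open>P\<close>.\<close>

lemma mincard_family_ex:
  assumes "P N"
  shows "P (mincard_family P) \<and> (\<forall>M. P M \<longrightarrow> |mincard_family P| \<le>o |M| )"
proof -
  have "card_of ` Collect P \<noteq> {}" "\<forall>r \<in> card_of ` Collect P. Card_order r"
    using assms by auto
  then obtain r where "r \<in> card_of ` Collect P" "\<forall>r' \<in> card_of ` Collect P. r \<le>o r'"
    using exists_minim_Card_order by meson
  then have "\<exists>N. P N \<and> (\<forall>M. P M \<longrightarrow> |N| \<le>o |M| )"
    by auto
  then show ?thesis
    unfolding mincard_family_def by (rule someI_ex)
qed

lemma card_of_Fpow_ordLeq: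
  assumes "|A| \<le>o |K|" "infinite K"
  shows "|Fpow A| \<le>o |K|"
proof (cases "finite A")
  case True
  then have "finite (Fpow A)"
    by (simp add: Fpow_def)
  then show ?thesis
    using assms(2) by (simp add: ordLess_imp_ordLeq)
next
  case False
  then show ?thesis
    using assms(1) card_of_Fpow_infinite ordIso_ordLeq_trans by blast
qed

text \<open>By distributivity the finite unions of finite intersections already form a lattice. They
  are indexed by finite sets of finite subsets of \<open>W\<close>, and \<open>Fpow\<close> does not
  leave an infinite cardinal bound.\<close>

lemma lattice_of_sets_closure:
  assumes K: "|W| \<le>o |K|" "infinite K"
  obtains V where "W \<subseteq> Pow T \<Longrightarrow> W \<subseteq> V" "V \<subseteq> Pow T" "{} \<in> V" "T \<in> V"
    "\<And>A B. A \<in> V \<Longrightarrow> B \<in> V \<Longrightarrow> A \<union> B \<in> V"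
    "\<And>A B. A \<in> V \<Longrightarrow> B \<in> V \<Longrightarrow> A \<inter> B \<in> V"
    "|V| \<le>o |K|"
proof -
  \<comment> \<open>The factor \<open>T\<close> gives the empty intersection the value
    \<open>T\<close>; the empty union gives \<open>{}\<close>.\<close>
  define u where "u P = (\<Union>a\<in>P. T \<inter> \<Inter>a)" for P :: "'a set set set"
  define V where "V = u ` Fpow (Fpow W)"
  have card: "|V| \<le>o |K|"
    unfolding V_def
    by (rule ordLeq_transitive[OF card_of_image card_of_Fpow_ordLeq[OF card_of_Fpow_ordLeq[OF K] K(2)]])
  have "W \<subseteq> V" if "W \<subseteq> Pow T"
  proof
    fix w assume "w \<in> W"
    then have "{{w}} \<in> Fpow (Fpow W)" "u {{w}} = w"
      using that by (auto simp: Fpow_def u_def)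
    then show "w \<in> V"
      unfolding V_def by (metis image_eqI)
  qed
  moreover have "V \<subseteq> Pow T"
    by (auto simp: V_def u_def)
  moreover have "{} \<in> V"
    unfolding V_def by (rule image_eqI[of _ _ "{}"]) (auto simp: Fpow_def u_def)
  moreover have "T \<in> V"
    unfolding V_def by (rule image_eqI[of _ _ "{{}}"]) (auto simp: Fpow_def u_def)
  moreover have "A \<union> B \<in> V" if AB: "A \<in> V" "B \<in> V" for A B
  proof -
    obtain P Q where "P \<in> Fpow (Fpow W)" "A = u P" "Q \<in> Fpow (Fpow W)" "B = u Q"
      using AB unfolding V_def by blast
    then have "P \<union> Q \<in> Fpow (Fpow W)" "A \<union> B = u (P \<union> Q)"
      by (auto simp: Fpow_def u_def)
    then show ?thesis
      unfolding V_def by blast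
  qed
  moreover have "A \<inter> B \<in> V" if AB: "A \<in> V" "B \<in> V" for A B
  proof -
    obtain P Q where PQ: "P \<in> Fpow (Fpow W)" "A = u P" "Q \<in> Fpow (Fpow W)" "B = u Q"
      using AB unfolding V_def by blast
    \<comment> \<open>Distributivity: an intersection of two such unions is the union over all pairs
      of index sets, merged.\<close>
    define R where "R = (\<lambda>(a, b). a \<union> b) ` (P \<times> Q)"
    have "R \<in> Fpow (Fpow W)"
      using PQ(1,3) by (auto simp: Fpow_def R_def)
    moreover have "u R = (\<Union>a\<in>P. \<Union>b\<in>Q. T \<inter> \<Inter>(a \<union> b))"
      unfolding u_def R_def by blast
    moreover have "A \<inter> B = (\<Union>a\<in>P. \<Union>b\<in>Q. T \<inter> \<Inter>(a \<union> b))"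
      unfolding PQ(2,4) u_def by auto
    ultimately show ?thesis
      unfolding V_def by (metis image_eqI)
  qed
  ultimately show ?thesis
    using card by (rule that)
qed

section \<open>Separating compact sets by a small lattice\<close>

text \<open>Members may be neither open nor closed. Separation is expressed through interior and
  closure so that compactness applies on either side.\<close>

definition separating_lattice :: "'a topology \<Rightarrow> 'a set set \<Rightarrow> bool" where
  "separating_lattice Y V \<longleftrightarrow> V \<subseteq> Pow (topspace Y) \<and> topspace Y \<in> V \<and> {} \<in> V \<and>
     (\<forall>A\<in>V. \<forall>B\<in>V. A \<union> B \<in> V \<and> A \<inter> B \<in> V) \<and>
     (\<forall>x\<in>topspace Y. \<forall>y\<in>topspace Y. x \<noteq> y \<longrightarrow>
       (\<exists>W\<in>V. x \<in> Y interior_of W \<and> y \<notin> Y closure_of W))"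

lemma separating_latticeD:
  assumes "separating_lattice Y V"
  shows "\<And>A. A \<in> V \<Longrightarrow> A \<subseteq> topspace Y" "topspace Y \<in> V" "{} \<in> V"
    "\<And>A B. A \<in> V \<Longrightarrow> B \<in> V \<Longrightarrow> A \<union> B \<in> V"
    "\<And>A B. A \<in> V \<Longrightarrow> B \<in> V \<Longrightarrow> A \<inter> B \<in> V"
    "\<And>x y. x \<in> topspace Y \<Longrightarrow> y \<in> topspace Y \<Longrightarrow> x \<noteq> y \<Longrightarrow>
      \<exists>W\<in>V. x \<in> Y interior_of W \<and> y \<notin> Y closure_of W"
  using assms by (auto simp: separating_lattice_def)

text \<open>The complements of the closures of separating members cover \<open>B\<close>.
  Intersecting the members behind a finite subcover keeps \<open>x\<close> in the interior.\<close>

lemma lattice_separates_point_compact: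
  assumes V: "separating_lattice Y V"
    and x: "x \<in> topspace Y" and B: "compactin Y B" "x \<notin> B"
  shows "\<exists>W\<in>V. x \<in> Y interior_of W \<and> B \<inter> Y closure_of W = {}"
proof -
  have Bt: "B \<subseteq> topspace Y"
    using B(1) compactin_subset_topspace by blast
  have "\<forall>y\<in>B. \<exists>W\<in>V. x \<in> Y interior_of W \<and> y \<notin> Y closure_of W"
  proof
    fix y assume "y \<in> B"
    then show "\<exists>W\<in>V. x \<in> Y interior_of W \<and> y \<notin> Y closure_of W"
      using separating_latticeD(6)[OF V x] B(2) Bt by auto
  qed
  then obtain w where w: "\<And>y. y \<in> B \<Longrightarrow> w y \<in> V \<and> x \<in> Y interior_of w y \<and> y \<notin> Y closure_of w y"
    by metis
  have "\<exists>F. finite F \<and> F \<subseteq> (\<lambda>y. topspace Y - Y closure_of w y) ` B \<and> B \<subseteq> \<Union>F"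
    using w Bt by (intro compactinD[OF B(1)]) auto
  then obtain C where C: "finite C" "C \<subseteq> B" "B \<subseteq> (\<Union>y\<in>C. topspace Y - Y closure_of w y)"
    by (metis (no_types) finite_subset_image)
  have "\<exists>W\<in>V. x \<in> Y interior_of W \<and> (\<forall>y\<in>C. Y closure_of W \<subseteq> Y closure_of w y)"
    using C(1,2)
  proof induction
    case empty
    then show ?case using separating_latticeD(2)[OF V] x by (intro bexI[of _ "topspace Y"]) auto
  next
    case (insert y C)
    then obtain W where W: "W \<in> V" "x \<in> Y interior_of W" "\<forall>y\<in>C. Y closure_of W \<subseteq> Y closure_of w y"
      by auto
    have "Y closure_of (W \<inter> w y) \<subseteq> Y closure_of W \<inter> Y closure_of w y"
      by (simp add: closure_of_mono)
    then have "\<forall>z\<in>insert y C. Y closure_of (W \<inter> w y) \<subseteq> Y closure_of w z"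
      using W(3) by blast
    then show ?case
      using W(1,2) w[of y] insert.prems separating_latticeD(5)[OF V]
      by (intro bexI[of _ "W \<inter> w y"]) (simp_all add: interior_of_Int)
  qed
  then show ?thesis
    using C(3) by blast
qed

text \<open>Dual to the point case: interiors cover \<open>A\<close>, and the union of finitely many
  members still has closure missing \<open>B\<close>.\<close>

lemma lattice_separates_compact:
  assumes V: "separating_lattice Y V"
    and A: "compactin Y A" and B: "compactin Y B" and "A \<inter> B = {}"
  shows "\<exists>W\<in>V. A \<subseteq> Y interior_of W \<and> B \<inter> Y closure_of W = {}"
proof -
  have At: "A \<subseteq> topspace Y"
    using A compactin_subset_topspace by blast
  have "\<forall>x\<in>A. \<exists>W\<in>V. x \<in> Y interior_of W \<and> B \<inter> Y closure_of W = {}"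
    using lattice_separates_point_compact[OF V _ B] At \<open>A \<inter> B = {}\<close> by blast
  then obtain w where w: "\<And>x. x \<in> A \<Longrightarrow> w x \<in> V \<and> x \<in> Y interior_of w x \<and> B \<inter> Y closure_of w x = {}"
    by metis
  have "\<exists>F. finite F \<and> F \<subseteq> (\<lambda>x. Y interior_of w x) ` A \<and> A \<subseteq> \<Union>F"
    using w by (intro compactinD[OF A]) auto
  then obtain C where C: "finite C" "C \<subseteq> A" "A \<subseteq> (\<Union>x\<in>C. Y interior_of w x)"
    by (metis (no_types) finite_subset_image)
  have "\<exists>W\<in>V. (\<Union>x\<in>C. Y interior_of w x) \<subseteq> Y interior_of W \<and> B \<inter> Y closure_of W = {}"
    using C(1,2)
  proof induction
    case empty
    then show ?case using separating_latticeD(3)[OF V] by (intro bexI[of _ "{}"]) auto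
  next
    case (insert y C)
    then obtain W where W: "W \<in> V" "(\<Union>x\<in>C. Y interior_of w x) \<subseteq> Y interior_of W"
        "B \<inter> Y closure_of W = {}"
      by auto
    have "Y interior_of W \<union> Y interior_of w y \<subseteq> Y interior_of (W \<union> w y)"
      by (simp add: interior_of_mono)
    then show ?case
      using W w[of y] insert.prems separating_latticeD(4)[OF V]
      by (intro bexI[of _ "W \<union> w y"]) (auto simp: closure_of_Un)
  qed
  then show ?thesis
    using C(3) by blast
qed

text \<open>It suffices to choose one separating set for each pair of network members that can be
  separated at all; this costs only \<open>|N \<times> N|\<close> sets, and the generated lattice
  costs no more.\<close>

lemma network_separating_lattice:
  assumes Y: "regular_space Y" "Hausdorff_space Y"
    and N: "network_of Y N" and K: "|N| \<le>o |K|" "infinite K"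
  obtains V where "separating_lattice Y V" "|V| \<le>o |K|"
proof -
  define good where "good P U \<longleftrightarrow> U \<subseteq> topspace Y \<and> fst P \<subseteq> Y interior_of U \<and> snd P \<inter> Y closure_of U = {}"
    for P :: "'a set \<times> 'a set" and U
  define W where "W = (\<lambda>P. SOME U. good P U) ` {P \<in> N \<times> N. \<exists>U. good P U}"
  have good: "good P (SOME U. good P U)" if "\<exists>U. good P U" for P
    using that by (rule someI_ex)
  have "|N \<times> N| \<le>o |K|"
    using card_of_Times_ordLeq_infinite[OF K(2) K(1) K(1)] .
  moreover have "|W| \<le>o |N \<times> N|"
    unfolding W_def by (rule ordLeq_transitive[OF card_of_image card_of_mono1]) blast
  ultimately have "|W| \<le>o |K|"
    using ordLeq_transitive by blast
  then obtain V where V: "W \<subseteq> Pow (topspace Y) \<Longrightarrow> W \<subseteq> V" "V \<subseteq> Pow (topspace Y)" "{} \<in> V" "topspace Y \<in> V"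
    "\<And>A B. A \<in> V \<Longrightarrow> B \<in> V \<Longrightarrow> A \<union> B \<in> V"
    "\<And>A B. A \<in> V \<Longrightarrow> B \<in> V \<Longrightarrow> A \<inter> B \<in> V"
    "|V| \<le>o |K|"
    using lattice_of_sets_closure[OF _ K(2), of W "topspace Y"] by metis
  have "W \<subseteq> Pow (topspace Y)"
  proof
    fix U assume "U \<in> W"
    then obtain P where "U = (SOME U. good P U)" "\<exists>U. good P U"
      unfolding W_def by blast
    then have "good P U"
      using good by blast
    then show "U \<in> Pow (topspace Y)"
      by (simp add: good_def)
  qed
  then have "W \<subseteq> V"
    by (rule V(1))
  moreover have "\<exists>U\<in>W. x \<in> Y interior_of U \<and> y \<notin> Y closure_of U"
    if xy: "x \<in> topspace Y" "y \<in> topspace Y" "x \<noteq> y" for x y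
  proof -
    \<comment> \<open>This \<open>U\<close> need not belong to \<open>W\<close>. It only shows that
      a pair of network members around \<open>x\<close> and \<open>y\<close> is separable; the set
      chosen for that pair then separates the points.\<close>
    obtain U where U: "openin Y U" "x \<in> U" "disjnt {y} (Y closure_of U)"
      using Y xy unfolding regular_space
      by (metis Diff_iff Hausdorff_imp_t1_space closedin_t1_singleton singletonD)
    obtain A where A: "A \<in> N" "x \<in> A" "A \<subseteq> U"
      using N U unfolding network_of_def by blast
    have "openin Y (topspace Y - Y closure_of U)" "y \<in> topspace Y - Y closure_of U"
      using U xy by auto
    then obtain B where B: "B \<in> N" "y \<in> B" "B \<subseteq> topspace Y - Y closure_of U"
      using N unfolding network_of_def by meson
    have "good (A, B) U"
      using A B U openin_subset[OF U(1)] by (auto simp: good_def interior_of_openin)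
    then have "good (A, B) (SOME U. good (A, B) U)"
      using good by blast
    moreover have "(SOME U. good (A, B) U) \<in> W"
      unfolding W_def using A(1) B(1) \<open>good (A, B) U\<close> by blast
    ultimately show ?thesis
      using A B by (intro bexI) (auto simp: good_def)
  qed
  ultimately have "separating_lattice Y V"
    unfolding separating_lattice_def using V(2-6) by (simp add: subset_iff) metis
  then show ?thesis
    using V(7) by (rule that)
qed

text \<open>What a Nagami family leaves behind on the space itself: the members through a given
  point behave, against closed sets, as if the space were compact.\<close>

definition sigma_family :: "'a topology \<Rightarrow> 'a set set \<Rightarrow> bool" where
  "sigma_family Y H \<longleftrightarrow> (\<forall>y\<in>topspace Y. \<forall>\<C>.
     (\<forall>C\<in>\<C>. closedin Y C) \<and>
     (\<forall>\<A>. finite \<A> \<and> \<A> \<subseteq> {E\<in>H. y \<in> E} \<union> \<C> \<longrightarrow> topspace Y \<inter> \<Inter>\<A> \<noteq> {})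
     \<longrightarrow> topspace Y \<inter> \<Inter>({E\<in>H. y \<in> E} \<union> \<C>) \<noteq> {})"

lemma sigma_familyD:
  assumes "sigma_family Y H" "y \<in> topspace Y" "\<And>C. C \<in> \<C> \<Longrightarrow> closedin Y C"
    and "\<And>\<A>. finite \<A> \<Longrightarrow> \<A> \<subseteq> {E\<in>H. y \<in> E} \<union> \<C> \<Longrightarrow> topspace Y \<inter> \<Inter>\<A> \<noteq> {}"
  shows "topspace Y \<inter> \<Inter>({E\<in>H. y \<in> E} \<union> \<C>) \<noteq> {}"
  using assms(1)[unfolded sigma_family_def, rule_format, OF assms(2), of \<C>] assms(3,4) by blast

section \<open>The Stone-Cech compactification and traces of Nagami families\<close>

lemma topspace_beta:
  "topspace (beta Y) = sc_cube Y closure_of (sc_emb Y ` topspace Y)"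
  by (simp add: beta_def closure_of_subset_topspace inf.absorb2)

lemma sc_emb_in_cube: "y \<in> topspace Y \<Longrightarrow> sc_emb Y y \<in> topspace (sc_cube Y)"
  by (auto simp: sc_cube_def sc_emb_def scI_def continuous_map_def Pi_iff)

lemma sc_emb_in_beta: "y \<in> topspace Y \<Longrightarrow> sc_emb Y y \<in> topspace (beta Y)"
  unfolding topspace_beta
  by (rule subsetD[OF closure_of_subset]) (auto simp: sc_emb_in_cube)

lemma compact_space_beta: "compact_space (beta Y)"
proof -
  have "compact_space (sc_cube Y)"
    by (simp add: sc_cube_def compact_space_product_topology compact_space_subtopology)
  then show ?thesis
    unfolding beta_def
    by (intro compact_space_subtopology closedin_compact_space closedin_closure_of)
qed

lemma closedin_beta_coordinate:
  assumes "f \<in> scI Y"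
  shows "closedin (beta Y) {z \<in> topspace (beta Y). z f = c}"
proof -
  have "continuous_map (beta Y) (top_of_set {0..1}) (\<lambda>z. z f)"
    unfolding beta_def sc_cube_def
    by (intro continuous_map_from_subtopology continuous_map_product_projection assms)
  then have "continuous_map (beta Y) euclideanreal (\<lambda>z. z f)"
    by (simp add: continuous_map_in_subtopology)
  from closedin_continuous_map_preimage[OF this, of "{c}"] show ?thesis
    by simp
qed

text \<open>Supplies a Nagami family from which a minimal one can be taken: distinct points of the
  cube differ in some coordinate \<open>f\<close>, and a level set of \<open>f\<close> separates
  them.\<close>

lemma nagami_family_closed: "nagami_family Y {F. closedin (beta Y) F}"
proof -
  have "\<exists>F. closedin (beta Y) F \<and> sc_emb Y y \<in> F \<and> z \<notin> F"
    if y: "y \<in> topspace Y" and z: "z \<in> topspace (beta Y) - sc_emb Y ` topspace Y" for y z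
  proof -
    have "z \<in> topspace (sc_cube Y)" "sc_emb Y y \<noteq> z"
      using z y by (auto simp: beta_def)
    then obtain f where f: "f \<in> scI Y" "sc_emb Y y f \<noteq> z f"
      using sc_emb_in_cube[OF y] unfolding sc_cube_def topspace_product_topology
      by (metis PiE_ext)
    then show ?thesis
      using closedin_beta_coordinate[OF f(1), of "sc_emb Y y f"] sc_emb_in_beta[OF y] by force
  qed
  then show ?thesis
    by (auto simp: nagami_family_def)
qed

text \<open>Complete regularity gives a function that is 0 at \<open>x\<close> and 1 on
  \<open>C\<close>. It is a coordinate of the cube, and its level set at 1 is closed and contains
  the image of \<open>C\<close>.\<close>

lemma sc_emb_closure:
  assumes "completely_regular_space Y" "closedin Y C" "x \<in> topspace Y"
    and x: "sc_emb Y x \<in> beta Y closure_of (sc_emb Y ` C)"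
  shows "x \<in> C"
proof (rule ccontr)
  assume "x \<notin> C"
  then obtain f where f: "continuous_map Y (top_of_set {0..1::real}) f" "f x = 0" "f ` C \<subseteq> {1}"
    using assms unfolding completely_regular_space_def by (metis DiffI)
  define g where "g = restrict f (topspace Y)"
  have g: "g \<in> scI Y"
    using f(1) by (auto simp: g_def scI_def)
  have C: "C \<subseteq> topspace Y"
    using assms(2) closedin_subset by blast
  have "sc_emb Y ` C \<subseteq> {z \<in> topspace (beta Y). z g = 1}"
    using C f(3) g sc_emb_in_beta by (fastforce simp: sc_emb_def g_def)
  then have "sc_emb Y x g = 1"
    using closure_of_minimal[OF _ closedin_beta_coordinate[OF g]] x by blast
  then show False
    using f(2) g assms(3) by (auto simp: sc_emb_def g_def)
qed

text \<open>The finite intersection property is carried to \<open>beta Y\<close>, where compactness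
  yields a common point. The Nagami family forces this point into the image of \<open>Y\<close>, and
  \<open>sc_emb_closure\<close> brings it back into the given closed sets.\<close>

lemma nagami_sigma_family:
  assumes Y: "completely_regular_space Y" and F: "nagami_family Y \<F>"
  shows "sigma_family Y ((\<lambda>F. {x \<in> topspace Y. sc_emb Y x \<in> F}) ` \<F>)"
  unfolding sigma_family_def
proof (intro ballI allI impI, elim conjE)
  \<comment> \<open>\<open>t\<close> takes traces on \<open>Y\<close>; \<open>k\<close> turns closed
    sets of \<open>Y\<close> into closed sets of \<open>beta Y\<close>.\<close>
  define t where "t F = {x \<in> topspace Y. sc_emb Y x \<in> F}" for F
  define k where "k C = beta Y closure_of (sc_emb Y ` C)" for C
  fix y \<C>
  assume y: "y \<in> topspace Y" and cl: "\<forall>C\<in>\<C>. closedin Y C"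
    and "\<forall>\<A>. finite \<A> \<and> \<A> \<subseteq> {E \<in> (\<lambda>F. {x \<in> topspace Y. sc_emb Y x \<in> F}) ` \<F>. y \<in> E} \<union> \<C>
        \<longrightarrow> topspace Y \<inter> \<Inter>\<A> \<noteq> {}"
  then have fip: "topspace Y \<inter> \<Inter>\<A> \<noteq> {}" if "finite \<A>" "\<A> \<subseteq> {E \<in> t ` \<F>. y \<in> E} \<union> \<C>" for \<A>
    using that by (simp add: t_def[abs_def])
  define \<F>y where "\<F>y = {F \<in> \<F>. sc_emb Y y \<in> F}"
  have "topspace (beta Y) \<inter> \<Inter>\<A> \<noteq> {}" if A: "finite \<A>" "\<A> \<subseteq> \<F>y \<union> k ` \<C>" for \<A>
  proof -
    have "finite (\<A> \<inter> k ` \<C>)" using A by blast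
    \<comment> \<open>Finitely many closures come from finitely many members of \<open>\<C>\<close>,
      so \<open>fip\<close> applies back in \<open>Y\<close>.\<close>
    then obtain \<C>0 where C0: "finite \<C>0" "\<C>0 \<subseteq> \<C>" "\<A> \<inter> k ` \<C> = k ` \<C>0"
      by (metis finite_subset_image inf_le2)
    have "t ` (\<A> \<inter> \<F>y) \<union> \<C>0 \<subseteq> {E \<in> t ` \<F>. y \<in> E} \<union> \<C>" "finite (t ` (\<A> \<inter> \<F>y) \<union> \<C>0)"
      using C0 A y by (auto simp: \<F>y_def t_def)
    then have "topspace Y \<inter> \<Inter>(t ` (\<A> \<inter> \<F>y) \<union> \<C>0) \<noteq> {}"
      by (intro fip)
    then obtain x where x: "x \<in> topspace Y" "\<forall>E \<in> t ` (\<A> \<inter> \<F>y) \<union> \<C>0. x \<in> E"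
      by blast
    have "sc_emb Y x \<in> D" if D: "D \<in> \<A>" for D
    proof (cases "D \<in> \<F>y")
      case True
      then have "x \<in> t D"
        using x(2) D by blast
      then show ?thesis
        by (simp add: t_def)
    next
      case False
      then have "D \<in> \<A> \<inter> k ` \<C>"
        using A(2) D by blast
      then obtain C where C: "C \<in> \<C>0" "D = k C"
        unfolding C0(3) by blast
      then have "closedin Y C"
        using cl C0(2) by blast
      then have "C \<subseteq> topspace Y"
        by (rule closedin_subset)
      then have "sc_emb Y ` C \<subseteq> topspace (beta Y)"
        by (metis image_subsetI sc_emb_in_beta subsetD)
      then have "sc_emb Y ` C \<subseteq> k C"
        unfolding k_def by (rule closure_of_subset)
      moreover have "x \<in> C"
        using x(2) C(1) by blast
      ultimately show ?thesis
        unfolding C(2) by blast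
    qed
    then show ?thesis
      using sc_emb_in_beta[OF x(1)] by blast
  qed
  moreover have "closedin (beta Y) D" if "D \<in> \<F>y \<union> k ` \<C>" for D
    using that F unfolding \<F>y_def k_def nagami_family_def by auto
  moreover have "compactin (beta Y) (topspace (beta Y))"
    using compact_space_beta by (simp add: compact_space_def)
  ultimately have "topspace (beta Y) \<inter> \<Inter>(\<F>y \<union> k ` \<C>) \<noteq> {}"
    unfolding compactin_fip by meson
  then obtain z where z: "z \<in> topspace (beta Y)" "\<forall>D\<in>\<F>y \<union> k ` \<C>. z \<in> D"
    by blast
  \<comment> \<open>Otherwise some member of the family through the image of \<open>y\<close> would
    omit \<open>z\<close>, although \<open>z\<close> lies in all of them.\<close>
  have "z \<in> sc_emb Y ` topspace Y"
  proof (rule ccontr)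
    assume "z \<notin> sc_emb Y ` topspace Y"
    then obtain F where "F \<in> \<F>" "sc_emb Y y \<in> F" "z \<notin> F"
      using F z(1) y unfolding nagami_family_def by blast
    then show False
      using z(2) by (auto simp: \<F>y_def)
  qed
  then obtain x where x: "x \<in> topspace Y" "z = sc_emb Y x"
    by blast
  have "x \<in> E" if "E \<in> {E \<in> t ` \<F>. y \<in> E}" for E
    using that x z by (auto simp: t_def \<F>y_def)
  moreover have "x \<in> C" if "C \<in> \<C>" for C
  proof -
    have "sc_emb Y x \<in> k C"
      using z(2) x(2) that by blast
    then show ?thesis
      unfolding k_def using that cl by (intro sc_emb_closure[OF Y _ x(1)]) auto
  qed
  ultimately show "topspace Y \<inter> \<Inter>({E \<in> (\<lambda>F. {x \<in> topspace Y. sc_emb Y x \<in> F}) ` \<F>. y \<in> E} \<union> \<C>) \<noteq> {}"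
    using x(1) unfolding t_def[abs_def] by blast
qed

section \<open>Separating disjoint closed sets by patches\<close>

text \<open>Contrapositive of the defining property for the single closed set \<open>C\<close>: a
  finite subfamily already has empty intersection, and \<open>C\<close> is then removed from
  it.\<close>

lemma sigma_family_avoids:
  assumes "sigma_family Y H" "y \<in> topspace Y" "closedin Y C"
    and "topspace Y \<inter> \<Inter>{E\<in>H. y \<in> E} \<inter> C = {}"
  obtains \<A> where "finite \<A>" "\<A> \<subseteq> H" "y \<in> \<Inter>\<A>" "\<Inter>\<A> \<inter> C = {}"
proof -
  have "\<not> (\<forall>\<A>. finite \<A> \<and> \<A> \<subseteq> {E\<in>H. y \<in> E} \<union> {C} \<longrightarrow> topspace Y \<inter> \<Inter>\<A> \<noteq> {})"
  proof
    assume "\<forall>\<A>. finite \<A> \<and> \<A> \<subseteq> {E\<in>H. y \<in> E} \<union> {C} \<longrightarrow> topspace Y \<inter> \<Inter>\<A> \<noteq> {}"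
    then have "topspace Y \<inter> \<Inter>({E\<in>H. y \<in> E} \<union> {C}) \<noteq> {}"
      using assms(3) by (intro sigma_familyD[OF assms(1,2)]) simp_all
    moreover have "topspace Y \<inter> \<Inter>({E\<in>H. y \<in> E} \<union> {C}) = topspace Y \<inter> \<Inter>{E\<in>H. y \<in> E} \<inter> C"
      by (simp add: Int_commute Int_left_commute)
    ultimately show False
      using assms(4) by simp
  qed
  then obtain \<A> where A: "finite \<A>" "\<A> \<subseteq> {E\<in>H. y \<in> E} \<union> {C}" "topspace Y \<inter> \<Inter>\<A> = {}"
    by blast
  have "C \<subseteq> topspace Y"
    using assms(3) closedin_subset by blast
  then have "\<Inter>(\<A> - {C}) \<inter> C = {}"
    using A by blast
  then show ?thesis
    using that[of "\<A> - {C}"] A by blast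
qed

text \<open>Closed sets with the finite intersection property relative to this set keep it when the
  members of \<open>H\<close> through \<open>y\<close> are added.\<close>

lemma sigma_family_compactin:
  assumes H: "sigma_family Y H" and y: "y \<in> topspace Y"
  shows "compactin Y (topspace Y \<inter> \<Inter>{E\<in>H. y \<in> E})"
  unfolding compactin_fip
proof (intro conjI allI impI)
  let ?K = "topspace Y \<inter> \<Inter>{E\<in>H. y \<in> E}"
  fix \<C> assume *: "(\<forall>C\<in>\<C>. closedin Y C) \<and>
    (\<forall>\<A>. finite \<A> \<and> \<A> \<subseteq> \<C> \<longrightarrow> ?K \<inter> \<Inter>\<A> \<noteq> {})"
  have "topspace Y \<inter> \<Inter>\<A> \<noteq> {}" if "finite \<A>" "\<A> \<subseteq> {E\<in>H. y \<in> E} \<union> \<C>" for \<A>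
  proof -
    have "?K \<inter> \<Inter>(\<A> \<inter> \<C>) \<noteq> {}"
      using * that by simp
    moreover have "?K \<inter> \<Inter>(\<A> \<inter> \<C>) \<subseteq> topspace Y \<inter> \<Inter>\<A>"
      using that(2) by blast
    ultimately show ?thesis
      by (metis subset_empty)
  qed
  then have "topspace Y \<inter> \<Inter>({E\<in>H. y \<in> E} \<union> \<C>) \<noteq> {}"
    using * by (intro sigma_familyD[OF H y]) simp_all
  then show "?K \<inter> \<Inter>\<C> \<noteq> {}"
    by (simp add: Inter_Un_distrib inf_assoc)
qed auto

text \<open>What \<open>W\<close> leaves wrong is \<open>A - Y interior_of W\<close> and
  \<open>B \<inter> Y closure_of W\<close>. Both are closed and miss \<open>K\<close>, so finitely
  many members of \<open>H\<close> through \<open>y\<close> avoid each of them.\<close>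

lemma sigma_family_local_separation:
  assumes V: "separating_lattice Y V"
    and H: "sigma_family Y H"
    and A: "closedin Y A" and B: "closedin Y B" and AB: "A \<inter> B = {}" and y: "y \<in> topspace Y"
  obtains \<A> W where "finite \<A>" "\<A> \<subseteq> H" "y \<in> \<Inter>\<A>" "W \<in> V"
    "\<Inter>\<A> \<inter> A \<subseteq> W" "\<Inter>\<A> \<inter> W \<inter> B = {}"
proof -
  define K where "K = topspace Y \<inter> \<Inter>{E\<in>H. y \<in> E}"
  have "compactin Y K"
    unfolding K_def by (rule sigma_family_compactin[OF H y])
  then have K: "compactin Y (K \<inter> A)" "compactin Y (K \<inter> B)"
    using A B by (auto intro: compact_Int_closedin)
  obtain W where W: "W \<in> V" "K \<inter> A \<subseteq> Y interior_of W" "(K \<inter> B) \<inter> Y closure_of W = {}"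
    using lattice_separates_compact[OF V K] AB by blast
  obtain \<A>1 where A1: "finite \<A>1" "\<A>1 \<subseteq> H" "y \<in> \<Inter>\<A>1" "\<Inter>\<A>1 \<inter> (A - Y interior_of W) = {}"
  proof (rule sigma_family_avoids[OF H y])
    show "closedin Y (A - Y interior_of W)"
      using A by (simp add: closedin_diff)
    show "topspace Y \<inter> \<Inter>{E\<in>H. y \<in> E} \<inter> (A - Y interior_of W) = {}"
      using W(2) unfolding K_def by (simp add: set_eq_iff subset_iff) blast
  qed
  obtain \<A>2 where A2: "finite \<A>2" "\<A>2 \<subseteq> H" "y \<in> \<Inter>\<A>2" "\<Inter>\<A>2 \<inter> (B \<inter> Y closure_of W) = {}"
  proof (rule sigma_family_avoids[OF H y])
    show "closedin Y (B \<inter> Y closure_of W)"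
      using B by (simp add: closedin_Int)
    show "topspace Y \<inter> \<Inter>{E\<in>H. y \<in> E} \<inter> (B \<inter> Y closure_of W) = {}"
      using W(3) by (simp add: K_def inf_assoc)
  qed
  have "W \<subseteq> Y closure_of W" "Y interior_of W \<subseteq> W"
    using separating_latticeD(1)[OF V W(1)] by (rule closure_of_subset) (rule interior_of_subset)
  then show ?thesis
  proof (intro that[of "\<A>1 \<union> \<A>2" W])
    show "\<Inter>(\<A>1 \<union> \<A>2) \<inter> A \<subseteq> W"
      using A1(4) \<open>Y interior_of W \<subseteq> W\<close> by blast
    show "\<Inter>(\<A>1 \<union> \<A>2) \<inter> W \<inter> B = {}"
      using A2(4) \<open>W \<subseteq> Y closure_of W\<close> by blast
  qed (use A1 A2 W(1) in auto)
qed

text \<open>The set coded by \<open>g\<close>, one lattice member per finite subfamily; such sets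
  are thus counted by maps from \<open>Fpow H\<close> to \<open>V\<close>.\<close>

definition patch :: "'a set set \<Rightarrow> ('a set set \<Rightarrow> 'a set) \<Rightarrow> 'a set" where
  "patch H g = (\<Union>\<A>\<in>Fpow H. \<Inter>\<A> \<inter> g \<A>)"

text \<open>The local choice of \<open>W\<close> can be made to depend on \<open>\<A>\<close> alone,
  not on the point. Each piece misses \<open>B\<close>, hence so does the union, while every point
  of \<open>A\<close> lies in some piece.\<close>

lemma sigma_family_separation:
  assumes V: "separating_lattice Y V"
    and H: "sigma_family Y H"
    and A: "closedin Y A" and B: "closedin Y B" and AB: "A \<inter> B = {}"
  shows "\<exists>g. range g \<subseteq> V \<and> A \<subseteq> patch H g \<and> patch H g \<inter> B = {}"
proof -
  define good where "good \<A> W \<longleftrightarrow> W \<in> V \<and> \<Inter>\<A> \<inter> A \<subseteq> W \<and> \<Inter>\<A> \<inter> W \<inter> B = {}" for \<A> W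
  \<comment> \<open>Subfamilies without a suitable member get \<open>{}\<close>, which lies in
    \<open>V\<close> and adds nothing to the patch.\<close>
  define g where "g \<A> = (if \<exists>W. good \<A> W then SOME W. good \<A> W else {})" for \<A>
  have good: "good \<A> (g \<A>)" if "\<exists>W. good \<A> W" for \<A>
    using someI_ex[OF that] that by (simp add: g_def)
  have "g \<A> \<in> V \<and> \<Inter>\<A> \<inter> g \<A> \<inter> B = {}" for \<A>
    using good[of \<A>] separating_latticeD(3)[OF V] by (cases "\<exists>W. good \<A> W") (auto simp: good_def g_def)
  moreover have "y \<in> patch H g" if "y \<in> A" for y
  proof -
    have "y \<in> topspace Y"
      using that A closedin_subset by blast
    then obtain \<A> W where "finite \<A>" "\<A> \<subseteq> H" "y \<in> \<Inter>\<A>" "good \<A> W"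
      using sigma_family_local_separation[OF V H A B AB] unfolding good_def by metis
    then show ?thesis
      using good[of \<A>] that unfolding patch_def Fpow_def good_def by blast
  qed
  ultimately show ?thesis
    by (intro exI[of _ g]) (auto simp: patch_def)
qed

section \<open>Coding and counting continuous functions\<close>

text \<open>Patches for all rational pairs determine a function on \<open>Y\<close>. The last
  assumption lets \<open>\<Phi>\<close> consist of functions on a larger space that are determined
  by their values on \<open>Y\<close>.\<close>

lemma card_of_continuous_functions:
  assumes V: "separating_lattice Y V"
    and H: "sigma_family Y H"
    and cont: "\<And>f. f \<in> \<Phi> \<Longrightarrow> continuous_map Y euclideanreal f"
    and det: "\<And>f g. f \<in> \<Phi> \<Longrightarrow> g \<in> \<Phi> \<Longrightarrow> (\<And>y. y \<in> topspace Y \<Longrightarrow> f y = g y) \<Longrightarrow> f = g"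
  shows "|\<Phi>| \<le>o |Func ((UNIV :: (rat \<times> rat) set) \<times> Fpow H) V|"
proof -
  define I where "I = (UNIV :: (rat \<times> rat) set) \<times> Fpow H"
  define between where "between f p q E \<longleftrightarrow> {y \<in> topspace Y. f y \<le> of_rat p} \<subseteq> E \<and>
      E \<inter> {y \<in> topspace Y. f y \<ge> of_rat q} = {}" for f :: "'a \<Rightarrow> real" and p q :: rat and E
  define codes where "codes f G \<longleftrightarrow> (\<forall>p q. p < q \<longrightarrow> between f p q (patch H (\<lambda>\<A>. G ((p, q), \<A>))))"
    for f :: "'a \<Rightarrow> real" and G :: "(rat \<times> rat) \<times> 'a set set \<Rightarrow> 'a set"
  have "\<exists>G\<in>Func I V. codes f G" if f: "f \<in> \<Phi>" for f
  proof -
    have "\<exists>g. range g \<subseteq> V \<and> (p < q \<longrightarrow> between f p q (patch H g))" for p q :: rat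
    proof (cases "p < q")
      case True
      have "closedin Y {y \<in> topspace Y. f y \<in> {..of_rat p}}"
        "closedin Y {y \<in> topspace Y. f y \<in> {of_rat q..}}"
        by (intro closedin_continuous_map_preimage[OF cont[OF f]]; simp)+
      moreover have "{y \<in> topspace Y. f y \<in> {..of_rat p}} \<inter> {y \<in> topspace Y. f y \<in> {of_rat q..}} = {}"
        using True of_rat_less[of p q, where 'a = real] by force
      ultimately have "\<exists>g. range g \<subseteq> V \<and> {y \<in> topspace Y. f y \<in> {..of_rat p}} \<subseteq> patch H g \<and>
          patch H g \<inter> {y \<in> topspace Y. f y \<in> {of_rat q..}} = {}"
        by (rule sigma_family_separation[OF V H])
      then show ?thesis
        unfolding between_def by simp blast
    next
      \<comment> \<open>No condition is imposed here; the constant \<open>{}\<close> merely makes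
        the choice of \<open>g\<close> total.\<close>
      case False
      then show ?thesis
        using separating_latticeD(3)[OF V] by (intro exI[of _ "\<lambda>_. {}"]) auto
    qed
    then obtain g where g: "\<And>p q. range (g p q) \<subseteq> V"
      "\<And>p q. p < q \<Longrightarrow> between f p q (patch H (g p q))"
      by metis
    \<comment> \<open>\<open>Func\<close> requires \<open>undefined\<close> outside
      \<open>I\<close>. Patches read \<open>G\<close> only on \<open>Fpow H\<close>, so they do not
      change.\<close>
    define G where "G i = (if i \<in> I then g (fst (fst i)) (snd (fst i)) (snd i) else undefined)" for i
    have "G \<in> Func I V"
      using g(1) by (simp add: Func_def G_def range_subsetD)
    moreover have "patch H (\<lambda>\<A>. G ((p, q), \<A>)) = patch H (g p q)" for p q
      by (auto simp: patch_def G_def I_def)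
    then have "codes f G"
      using g(2) unfolding codes_def by presburger
    ultimately show ?thesis by blast
  qed
  then obtain G where G: "\<And>f. f \<in> \<Phi> \<Longrightarrow> G f \<in> Func I V \<and> codes f (G f)"
    by metis
  \<comment> \<open>If \<open>f y < p < q < h y\<close>, the common patch for \<open>(p, q)\<close>
    contains \<open>y\<close> because of \<open>f\<close> and omits \<open>y\<close> because of
    \<open>h\<close>.\<close>
  have le: "f y \<ge> h y" if fh: "codes f F" "codes h F" and y: "y \<in> topspace Y" for f h F y
  proof (rule ccontr)
    assume "\<not> h y \<le> f y"
    then obtain p q where "f y < of_rat p" "of_rat p < (of_rat q :: real)" "of_rat q < h y"
      using of_rat_dense by (metis not_le)
    moreover from this have "p < q"
      by (simp add: of_rat_less)
    ultimately have "y \<in> patch H (\<lambda>\<A>. F ((p, q), \<A>))" "y \<notin> patch H (\<lambda>\<A>. F ((p, q), \<A>))"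
      using fh y unfolding codes_def between_def by force+
    then show False by blast
  qed
  have "inj_on G \<Phi>"
  proof (rule inj_onI)
    fix f h assume "f \<in> \<Phi>" "h \<in> \<Phi>" "G f = G h"
    then show "f = h"
      using G[of f] G[of h] le[of f "G f" h] le[of h "G f" f] by (intro det antisym) auto
  qed
  then show ?thesis
    unfolding I_def[symmetric] using G card_of_ordLeq by blast
qed

text \<open>Density makes restriction to \<open>S\<close> injective on \<open>Cfun X\<close>, so
  counting codes on the subspace suffices.\<close>

lemma card_of_Cfun_dense:
  assumes X: "tychonoff_space X" and S: "S \<subseteq> topspace X" "X closure_of S = topspace X"
  shows "|Cfun X| \<le>o nw (subtopology X S) ^c Nag (subtopology X S)"
proof -
  define Y where "Y = subtopology X S"
  have tY: "topspace Y = S"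
    using S by (simp add: Y_def inf.absorb2)
  have cr: "completely_regular_space Y" and t1: "t1_space Y"
    using X by (auto simp: Y_def tychonoff_space_def completely_regular_space_subtopology t1_space_subtopology)
  then have reg: "regular_space Y" "Hausdorff_space Y"
    by (auto simp: completely_regular_imp_regular_space regular_t1_imp_Hausdorff_space)
  define N where "N = mincard_family (network_of Y)"
  define \<F> where "\<F> = mincard_family (nagami_family Y)"
  have "network_of Y (Pow (topspace Y))"
    by (auto simp: network_of_def dest: openin_subset)
  then have N: "network_of Y N"
    unfolding N_def using mincard_family_ex by blast
  have F: "nagami_family Y \<F>"
    unfolding \<F>_def using mincard_family_ex nagami_family_closed by blast
  define H where "H = (\<lambda>F. {x \<in> topspace Y. sc_emb Y x \<in> F}) ` \<F>"
  have H: "sigma_family Y H"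
    unfolding H_def by (rule nagami_sigma_family[OF cr F])
  \<comment> \<open>\<open>K\<close> and \<open>L\<close> are the sets whose cardinals are
    \<open>nw\<close> and \<open>Nag\<close>; the summand of naturals makes them infinite.\<close>
  define K where "K = N <+> (UNIV :: nat set)"
  define L where "L = \<F> <+> (UNIV :: nat set)"
  have "infinite K" "infinite L" "|N| \<le>o |K|" "|\<F>| \<le>o |L|" "|UNIV :: nat set| \<le>o |L|"
    by (auto simp: K_def L_def finite_Plus_iff card_of_Plus1 card_of_Plus2)
  obtain V where V: "separating_lattice Y V" and VK: "|V| \<le>o |K|"
    using network_separating_lattice[OF reg N \<open>|N| \<le>o |K|\<close> \<open>infinite K\<close>] by metis
  define I where "I = (UNIV :: (rat \<times> rat) set) \<times> Fpow H"
  have "|H| \<le>o |L|"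
    unfolding H_def using card_of_image \<open>|\<F>| \<le>o |L|\<close> ordLeq_transitive by blast
  then have "|Fpow H| \<le>o |L|"
    using \<open>infinite L\<close> by (rule card_of_Fpow_ordLeq)
  moreover have "|UNIV :: (rat \<times> rat) set| \<le>o |L|"
  proof (rule ordLeq_transitive[OF _ \<open>|UNIV :: nat set| \<le>o |L|\<close>])
    show "|UNIV :: (rat \<times> rat) set| \<le>o |UNIV :: nat set|"
      using inj_to_nat by (rule card_of_ordLeqI) simp
  qed
  ultimately have "|I| \<le>o |L|"
    unfolding I_def using \<open>infinite L\<close> by (intro card_of_Times_ordLeq_infinite)
  have "|Cfun X| \<le>o |Func I V|"
    unfolding I_def
  proof (rule card_of_continuous_functions[OF V H])
    show "continuous_map Y euclideanreal f" if "f \<in> Cfun X" for f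
      using that by (simp add: Cfun_def Y_def continuous_map_from_subtopology)
    fix f g assume f: "f \<in> Cfun X" and g: "g \<in> Cfun X" and eq: "\<And>y. y \<in> topspace Y \<Longrightarrow> f y = g y"
    have fg: "continuous_map X euclideanreal f" "continuous_map X euclideanreal g"
      "f \<in> extensional (topspace X)" "g \<in> extensional (topspace X)"
      using f g by (simp_all add: Cfun_def)
    show "f = g"
    proof (rule extensionalityI[OF fg(3,4)])
      fix x assume "x \<in> topspace X"
      then have "x \<in> X closure_of S"
        by (simp add: S(2))
      then show "f x = g x"
        by (rule forall_in_closure_of_eq[OF _ _ fg(1,2)]) (simp_all add: eq tY)
    qed
  qed
  also have "|Func I V| = |V| ^c |I|"
    by (simp add: cexp_def)
  also have "|V| ^c |I| \<le>o |K| ^c |L|"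
  proof (rule cexp_mono'[OF VK \<open>|I| \<le>o |L|\<close>])
    \<comment> \<open>Monotonicity of powers in the exponent can fail from exponent 0. The empty
      subfamily belongs to \<open>Fpow H\<close>, so \<open>I\<close> is nonempty.\<close>
    have "I \<noteq> {}"
      by (auto simp: I_def Fpow_def)
    then show "Field |I| = {} \<Longrightarrow> Field |L| = {}"
      by simp
  qed
  finally show ?thesis
    by (simp add: nw_def Nag_def Y_def K_def L_def N_def \<F>_def)
qed

section \<open>Cozero bases and the weight\<close>

lemma open_base_of_cozero_sets:
  assumes "completely_regular_space X"
  shows "open_base_of X ((\<lambda>f. {x \<in> topspace X. f x \<noteq> 0}) ` Cfun X)"
  unfolding open_base_of_def
proof (intro conjI ballI allI impI, elim imageE)
  fix A f assume A: "A = {x \<in> topspace X. f x \<noteq> 0}" and f: "f \<in> Cfun X"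
  have "openin X {x \<in> topspace X. f x \<in> - {0}}"
    using f by (intro openin_continuous_map_preimage[of X euclideanreal]) (auto simp: Cfun_def)
  then show "openin X A"
    by (simp add: A)
next
  fix U x assume Ux: "openin X U \<and> x \<in> U"
  then obtain f where f: "continuous_map X euclideanreal f" "f x = 0" "f ` (topspace X - U) \<subseteq> {1}"
    using assms unfolding completely_regular_space_alt' by meson
  \<comment> \<open>Complete regularity gives 0 at \<open>x\<close> and 1 off \<open>U\<close>;
    \<open>1 - f\<close> reverses this, so the cozero set contains \<open>x\<close> and stays in
    \<open>U\<close>.\<close>
  define g where "g = restrict (\<lambda>x. 1 - f x) (topspace X)"
  have "continuous_map X euclideanreal (\<lambda>x. 1 - f x)"
    using f(1) by (intro continuous_intros) auto
  then have "g \<in> Cfun X"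
    by (auto simp: Cfun_def g_def)
  moreover have "x \<in> {x \<in> topspace X. g x \<noteq> 0}" "{x \<in> topspace X. g x \<noteq> 0} \<subseteq> U"
    using Ux f openin_subset by (fastforce simp: g_def)+
  ultimately show "\<exists>A\<in>(\<lambda>f. {x \<in> topspace X. f x \<noteq> 0}) ` Cfun X. x \<in> A \<and> A \<subseteq> U"
    by blast
qed

theorem theorem2:
  fixes X :: "'a topology" and S :: "'a set"
  assumes "tychonoff_space X"
    and "S \<subseteq> topspace X"
    and "X closure_of S = topspace X"
  shows "ordLeq2 (card_of (Cfun X)) (BNF_Cardinal_Arithmetic.cexp (nw (subtopology X S)) (Nag (subtopology X S)))
    \<and> ordLeq2 (wt X) (BNF_Cardinal_Arithmetic.cexp (nw (subtopology X S)) (Nag (subtopology X S)))"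
proof
  let ?n = "nw (subtopology X S)" and ?l = "Nag (subtopology X S)"
  show C: "|Cfun X| \<le>o ?n ^c ?l"
    using assms by (rule card_of_Cfun_dense)
  let ?\<B> = "(\<lambda>f. {x \<in> topspace X. f x \<noteq> 0}) ` Cfun X"
  have "open_base_of X ?\<B>"
    using assms(1) by (intro open_base_of_cozero_sets) (simp add: tychonoff_space_def)
  then have "|mincard_family (open_base_of X)| \<le>o |?\<B>|"
    using mincard_family_ex by blast
  also have "|?\<B>| \<le>o |Cfun X|"
    by (rule card_of_image)
  also note C
  finally have base: "|mincard_family (open_base_of X)| \<le>o ?n ^c ?l" .
  have n: "Cinfinite ?n"
    by (simp add: nw_def cinfinite_def finite_Plus_iff)
  have l: "Cinfinite ?l"
    by (simp add: Nag_def cinfinite_def finite_Plus_iff)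
  \<comment> \<open>The definition of \<open>wt\<close> adds a copy of the naturals to a minimal
    base; an infinite bound absorbs it.\<close>
  have inf: "Cinfinite (?n ^c ?l)"
    using n l by (intro Cinfinite_cexp) (auto intro: ordLess_imp_ordLeq simp: ctwo_ordLess_Cinfinite)
  have "|UNIV :: nat set| \<le>o ?n ^c ?l"
    using natLeq_ordLeq_cinfinite[OF inf] card_of_nat ordIso_ordLeq_trans by blast
  with base show "wt X \<le>o ?n ^c ?l"
    unfolding wt_def using inf
    by (intro card_of_Plus_ordLeq_infinite_Field) (auto simp: cinfinite_def)
qed

end
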